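(* Assume the null drift condition $\bar U=\sum_{y\in\bar{\mathcal S}}\rho(y)\pi(y)=0$. Let $\omega:\bar{\mathcal S}\to\mathbb R^d$ be a solution of the unit-cell problem $L^T\omega=\sigma$, and let $\psi:\bar{\mathcal S}\to\mathbb R^d$ satisfy $L\psi=\rho$. Put $$K=\frac12\sum_{y\in\bar{\mathcal S}}\sum_{e\in\mathcal E_y}\Big(\nu_e\nu_e^T\lambda_e\pi(y)-\nu_e\,\omega(y)^T\lambda_e-\omega(y)\,\nu_e^T\lambda_e\Big)$$ and $$C=\frac12\sum_{e\in\bar{\mathcal E}}\alpha_e\alpha_e^T\lambda_e\pi(\partial_-e),\qquad \alpha_e=\nu_e-\big(\psi(\partial_+e)-\psi(\partial_-e)\big).$$ Then $K=C$.
   Context: A weighted directed graph is a triple $(\mathcal S,\mathcal E,\lambda)$ with $\mathcal S\subset\mathbb R^d$ a countable set of nodes, $\mathcal E\subset\mathcal S\times\mathcal S$ the directed edges, and $\lambda:\mathcal E\to(0,\infty)$; write $\lambda_e=\lambda(e)$. Standing assumptions: the graph is strongly connected, has no edges of the form $(y,y)$, and is invariant under integer translations (for $n\in\mathbb Z^d$: $x\in\mathcal S\Rightarrow x+n\in\mathcal S$; $(x,y)\in\mathcal E\Rightarrow(x+n,y+n)\in\mathcal E$ and $\lambda(x+n,y+n)=\lambda(x,y)$). For $e=(x,y)\in\mathcal E$: $\partial_-e=x$, $\partial_+e=y$, $\nu_e=y-x$. For $y\in\mathcal S$: $\mathcal E_y=\{e\in\mathcal E:\partial_-e=y\}$, $\mathcal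 E'_y=\{e\in\mathcal E:\partial_+e=y\}$. $\bar{\mathcal S}$ is the quotient of $\mathcal S$ by $\mathbb Z^d$-translations, identified with $\mathcal S\cap[0,1)^d$. $\bar{\mathcal E}$ is the quotient of $\mathcal E$ by simultaneous translation of both endpoints by the same element of $\mathbb Z^d$, identified with $\bigcup_{y\in\bar{\mathcal S}}\mathcal E_y$. Both are assumed finite. Functions on $\bar{\mathcal S}$ are evaluated at nodes of $\mathcal S$ by reducing modulo $\mathbb Z^d$. $(Lf)(y)=\sum_{e\in\mathcal E_y}(f(y+\nu_e)-f(y))\lambda_e$ for $f:\bar{\mathcal S}\to\mathbb R$, $y\in\bar{\mathcal S}$, with transpose $(L^Tf)(y)=\sum_{e\in\mathcal E'_y}f(y-\nu_e)\lambda_e-f(y)\sum_{e\in\mathcal E_y}\lambda_e$; both act componentwise on $\mathbb R^d$-valued functions. $\pi$ is the unique function on $\bar{\mathcal S}$ with $L^T\pi=0$, $\sum_y\pi(y)=1$. $\rho(y)=\sum_{e\in\mathcal E_y}\nu_e\lambda_e$ and $\sigma(y)=\sum_{e\in\mathcal E'_y}\nu_e\lambda_e\pi(y-\nu_e)$. *)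

theory Defs
  imports "HOL-Analysis.Analysis" "Graph_Theory.Pair_Digraph" "Graph_Theory.Digraph_Component"
begin

definition int_lattice :: "(real ^ 'd) set" where
  "int_lattice = {n. \<forall>i. n $ i \<in> \<int>}"

definition unit_cell :: "(real ^ 'd) set" where
  "unit_cell = {x. \<forall>i. 0 \<le> x $ i \<and> x $ i < 1}"

text \<open>
  The representative in the unit cell of a point modulo integer translations. A function on the
  node quotient is modelled by a function on the whole space of which only the values at
  representatives in the unit cell are ever used; its value at an arbitrary node \<open>x\<close> of the
  periodic graph is therefore \<open>f (reduce x)\<close>, never \<open>f x\<close>.
\<close>

definition reduce :: "real ^ 'd \<Rightarrow> real ^ 'd" where
  "reduce x = (\<chi> i. frac (x $ i))"

lemma reduce_in_unit_cell: "reduce x \<in> unit_cell"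
  by (simp add: reduce_def unit_cell_def frac_lt_1)

lemma diff_reduce_in_int_lattice: "x - reduce x \<in> int_lattice"
  by (simp add: reduce_def int_lattice_def frac_def)

lemma reduce_id: "x \<in> unit_cell \<Longrightarrow> reduce x = x"
  by (simp add: reduce_def unit_cell_def vec_eq_iff frac_eq)

definition nodes_mod :: "(real ^ 'd) pair_pre_digraph \<Rightarrow> (real ^ 'd) set" where
  "nodes_mod G = pverts G \<inter> unit_cell"

definition edges_mod :: "(real ^ 'd) pair_pre_digraph \<Rightarrow> ((real ^ 'd) \<times> (real ^ 'd)) set" where
  "edges_mod G = (\<Union>y\<in>nodes_mod G. out_arcs G y)"

locale periodic_weighted_digraph = pair_loopfree_digraph G
  for G :: "(real ^ 'd) pair_pre_digraph" +
  fixes lam :: "(real ^ 'd) \<times> (real ^ 'd) \<Rightarrow> real"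
  assumes countable_nodes: "countable (pverts G)"
    and rate_pos: "e \<in> parcs G \<Longrightarrow> 0 < lam e"
    and strongly_conn: "strongly_connected G"
    and node_translate: "n \<in> int_lattice \<Longrightarrow> x \<in> pverts G \<Longrightarrow> x + n \<in> pverts G"
    and edge_translate: "n \<in> int_lattice \<Longrightarrow> (x, y) \<in> parcs G \<Longrightarrow> (x + n, y + n) \<in> parcs G"
    and rate_translate: "n \<in> int_lattice \<Longrightarrow> (x, y) \<in> parcs G \<Longrightarrow> lam (x + n, y + n) = lam (x, y)"
    and finite_nodes_mod: "finite (nodes_mod G)"
    and finite_edges_mod: "finite (edges_mod G)"

definition jump :: "(real ^ 'd) \<times> (real ^ 'd) \<Rightarrow> real ^ 'd" where
  "jump e = snd e - fst e"

text \<open>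
  The generator and its transpose are meant for arguments in \<^term>\<open>nodes_mod G\<close>. They are stated
  for values in any real vector space; on vector-valued functions they act componentwise.
\<close>

definition gen ::
    "(real ^ 'd) pair_pre_digraph \<Rightarrow> ((real ^ 'd) \<times> (real ^ 'd) \<Rightarrow> real) \<Rightarrow>
     (real ^ 'd \<Rightarrow> 'b::real_vector) \<Rightarrow> real ^ 'd \<Rightarrow> 'b" where
  "gen G lam f y = (\<Sum>e\<in>out_arcs G y. lam e *\<^sub>R (f (reduce (y + jump e)) - f y))"

definition gen_transpose ::
    "(real ^ 'd) pair_pre_digraph \<Rightarrow> ((real ^ 'd) \<times> (real ^ 'd) \<Rightarrow> real) \<Rightarrow>
     (real ^ 'd \<Rightarrow> 'b::real_vector) \<Rightarrow> real ^ 'd \<Rightarrow> 'b" where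
  "gen_transpose G lam f y =
     (\<Sum>e\<in>in_arcs G y. lam e *\<^sub>R f (reduce (y - jump e))) - (\<Sum>e\<in>out_arcs G y. lam e) *\<^sub>R f y"

lemma gen_component: "gen G lam f y $ i = gen G lam (\<lambda>z. f z $ i) y"
  by (simp add: gen_def)

lemma gen_transpose_component:
  "gen_transpose G lam f y $ i = gen_transpose G lam (\<lambda>z. f z $ i) y"
  by (simp add: gen_transpose_def)

text \<open>
  For a \<^term>\<open>periodic_weighted_digraph\<close> these equations determine \<open>\<pi>\<close> uniquely on
  \<^term>\<open>nodes_mod G\<close>, so neither uniqueness nor positivity is part of the definition.
\<close>

definition stationary_distribution ::
    "(real ^ 'd) pair_pre_digraph \<Rightarrow> ((real ^ 'd) \<times> (real ^ 'd) \<Rightarrow> real) \<Rightarrow>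
     (real ^ 'd \<Rightarrow> real) \<Rightarrow> bool" where
  "stationary_distribution G lam \<pi> \<longleftrightarrow>
     (\<forall>y\<in>nodes_mod G. gen_transpose G lam \<pi> y = 0) \<and> (\<Sum>y\<in>nodes_mod G. \<pi> y) = 1"

definition drift ::
    "(real ^ 'd) pair_pre_digraph \<Rightarrow> ((real ^ 'd) \<times> (real ^ 'd) \<Rightarrow> real) \<Rightarrow> real ^ 'd \<Rightarrow> real ^ 'd" where
  "drift G lam y = (\<Sum>e\<in>out_arcs G y. lam e *\<^sub>R jump e)"

definition cell_source ::
    "(real ^ 'd) pair_pre_digraph \<Rightarrow> ((real ^ 'd) \<times> (real ^ 'd) \<Rightarrow> real) \<Rightarrow>
     (real ^ 'd \<Rightarrow> real) \<Rightarrow> real ^ 'd \<Rightarrow> real ^ 'd" where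
  "cell_source G lam \<pi> y = (\<Sum>e\<in>in_arcs G y. (lam e * \<pi> (reduce (y - jump e))) *\<^sub>R jump e)"

definition mean_drift ::
    "(real ^ 'd) pair_pre_digraph \<Rightarrow> ((real ^ 'd) \<times> (real ^ 'd) \<Rightarrow> real) \<Rightarrow>
     (real ^ 'd \<Rightarrow> real) \<Rightarrow> real ^ 'd" where
  "mean_drift G lam \<pi> = (\<Sum>y\<in>nodes_mod G. \<pi> y *\<^sub>R drift G lam y)"

definition outer :: "real ^ 'm \<Rightarrow> real ^ 'n \<Rightarrow> real ^ 'n ^ 'm" where
  "outer v w = (\<chi> i j. v $ i * w $ j)"

lemma outer_eq_columnvector_rowvector:
  "outer v w = (columnvector v :: real ^ 1 ^ 'm) ** (rowvector w :: real ^ 'n ^ 1)"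
  by (simp add: outer_def columnvector_def rowvector_def matrix_matrix_mult_def vec_eq_iff)

definition diffusivity_cell ::
    "(real ^ 'd) pair_pre_digraph \<Rightarrow> ((real ^ 'd) \<times> (real ^ 'd) \<Rightarrow> real) \<Rightarrow>
     (real ^ 'd \<Rightarrow> real) \<Rightarrow> (real ^ 'd \<Rightarrow> real ^ 'd) \<Rightarrow> real ^ 'd ^ 'd" where
  "diffusivity_cell G lam \<pi> \<omega> =
     (1/2) *\<^sub>R (\<Sum>y\<in>nodes_mod G. \<Sum>e\<in>out_arcs G y.
       (lam e * \<pi> y) *\<^sub>R outer (jump e) (jump e)
       - lam e *\<^sub>R outer (jump e) (\<omega> y) - lam e *\<^sub>R outer (\<omega> y) (jump e))"

definition corrected_jump ::
    "(real ^ 'd \<Rightarrow> real ^ 'd) \<Rightarrow> (real ^ 'd) \<times> (real ^ 'd) \<Rightarrow> real ^ 'd" where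
  "corrected_jump \<psi> e = jump e - (\<psi> (reduce (snd e)) - \<psi> (reduce (fst e)))"

definition diffusivity_clt ::
    "(real ^ 'd) pair_pre_digraph \<Rightarrow> ((real ^ 'd) \<times> (real ^ 'd) \<Rightarrow> real) \<Rightarrow>
     (real ^ 'd \<Rightarrow> real) \<Rightarrow> (real ^ 'd \<Rightarrow> real ^ 'd) \<Rightarrow> real ^ 'd ^ 'd" where
  "diffusivity_clt G lam \<pi> \<psi> =
     (1/2) *\<^sub>R (\<Sum>e\<in>edges_mod G.
       (lam e * \<pi> (reduce (fst e))) *\<^sub>R outer (corrected_jump \<psi> e) (corrected_jump \<psi> e))"

end

theory Submission
  imports Defs
begin

text \<open>
  Both matrices are sums over edge classes, and the term \<open>\<nu>\<^sub>i \<nu>\<^sub>j \<lambda> \<pi>\<close> is common to them, so only the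
  cross terms have to be compared, one matrix entry at a time. Three ingredients do this.

  Summation by parts on the quotient graph (lemma \<open>sum_gen_transpose\<close>) says that \<open>L\<^sup>T\<close> is the adjoint
  of \<open>L\<close>. It rests on the fact that a translation-invariant edge function has the same sum whether
  edge classes are represented by the edges that leave the unit cell or by those that enter it.

  Applied to \<open>L \<psi>\<^sub>i = \<rho>\<^sub>i\<close> and \<open>L\<^sup>T \<omega>\<^sub>j = \<sigma>\<^sub>j\<close>, this duality trades \<open>\<omega>\<close> for \<open>\<psi>\<close>:
  \<open>\<Sum> \<nu>\<^sub>i \<omega>\<^sub>j(\<partial>\<^sub>-e) \<lambda> = \<langle>\<rho>\<^sub>i, \<omega>\<^sub>j\<rangle> = \<langle>\<psi>\<^sub>i, \<sigma>\<^sub>j\<rangle> = \<Sum> \<psi>\<^sub>i(\<partial>\<^sub>+e) \<nu>\<^sub>j \<lambda> \<pi>(\<partial>\<^sub>-e)\<close>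
  (lemma \<open>sum_jump_cell_solution\<close>).

  Applied to \<open>L\<^sup>T \<pi> = 0\<close>, it makes \<open>L(\<psi>\<^sub>i \<psi>\<^sub>j)\<close> have \<open>\<pi>\<close>-mean zero, so that the
  Dirichlet form of \<open>\<psi>\<^sub>i\<close> and \<open>\<psi>\<^sub>j\<close> is
  \<open>- \<langle>\<pi>, \<psi>\<^sub>i \<rho>\<^sub>j + \<psi>\<^sub>j \<rho>\<^sub>i\<rangle>\<close> (lemma \<open>dirichlet_form_eq\<close>). In the expansion of
  \<open>\<alpha>\<^sub>i \<alpha>\<^sub>j\<close> this cancels exactly the cross terms with \<open>\<psi>(\<partial>\<^sub>-e)\<close>, and the surviving cross terms, those
  with \<open>\<psi>(\<partial>\<^sub>+e)\<close>, are the ones that duality has matched with \<open>\<omega>\<close>.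
\<close>

section \<open>Sums over edge classes of the quotient graph\<close>

lemma reduce_translate:
  assumes "n \<in> int_lattice"
  shows "reduce (x + n) = reduce x"
proof -
  have "frac (x $ i + n $ i) = frac (x $ i)" for i
  proof -
    have "n $ i \<in> \<int>"
      using assms by (simp add: int_lattice_def)
    then obtain k where "n $ i = of_int k"
      by (auto elim: Ints_cases)
    then show ?thesis
      by (simp add: frac_def)
  qed
  then show ?thesis
    by (simp add: reduce_def vec_eq_iff)
qed

lemma int_lattice_uminus: "n \<in> int_lattice \<Longrightarrow> - n \<in> int_lattice"
  by (simp add: int_lattice_def)

lemma reduce_minus_self_in_int_lattice: "reduce x - x \<in> int_lattice"
  using int_lattice_uminus[OF diff_reduce_in_int_lattice] by simp

context periodic_weighted_digraph
begin

definition translation_invariant :: "((real ^ 'd) \<times> (real ^ 'd) \<Rightarrow> 'c) \<Rightarrow> bool" where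
  "translation_invariant F \<longleftrightarrow>
     (\<forall>n\<in>int_lattice. \<forall>x y. (x, y) \<in> parcs G \<longrightarrow> F (x + n, y + n) = F (x, y))"

lemma node_of_arc: "(x, y) \<in> parcs G \<Longrightarrow> x \<in> pverts G \<and> y \<in> pverts G"
  using arc_fst_in_verts[of "(x, y)"] arc_snd_in_verts[of "(x, y)"] by simp

lemma reduce_node: "x \<in> pverts G \<Longrightarrow> reduce x \<in> nodes_mod G"
  using node_translate[OF reduce_minus_self_in_int_lattice, of x x]
  by (simp add: nodes_mod_def reduce_in_unit_cell)

lemma nodes_mod_reduce: "y \<in> nodes_mod G \<Longrightarrow> reduce y = y"
  by (simp add: nodes_mod_def reduce_id)

lemma edges_mod_iff: "(x, y) \<in> edges_mod G \<longleftrightarrow> (x, y) \<in> parcs G \<and> x \<in> unit_cell"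
  using node_of_arc by (auto simp: edges_mod_def nodes_mod_def out_arcs_def)

lemma finite_out_arcs_mod: "y \<in> nodes_mod G \<Longrightarrow> finite (out_arcs G y)"
  by (rule finite_subset[OF _ finite_edges_mod]) (auto simp: edges_mod_def)

text \<open>
  Finiteness of the set of edges into a node is inherited from the finiteness of the edge quotient:
  the endpoint is fixed, so an edge can be recovered from its class.
\<close>

lemma finite_in_arcs_mod:
  assumes "y \<in> nodes_mod G"
  shows "finite (in_arcs G y)"
proof (rule finite_subset)
  let ?f = "\<lambda>e. (fst e - (snd e - y), y)"
  show "in_arcs G y \<subseteq> ?f ` edges_mod G"
  proof
    fix e assume "e \<in> in_arcs G y"
    then obtain x where e: "e = (x, y)" "(x, y) \<in> parcs G"
      by (cases e) (auto simp: in_arcs_def)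
    let ?n = "reduce x - x"
    have "(x + ?n, y + ?n) \<in> edges_mod G"
      using edge_translate[OF reduce_minus_self_in_int_lattice e(2), of x] reduce_in_unit_cell[of x]
      by (simp add: edges_mod_iff)
    moreover have "e = ?f (x + ?n, y + ?n)"
      by (simp add: e)
    ultimately show "e \<in> ?f ` edges_mod G"
      by blast
  qed
  show "finite (?f ` edges_mod G)"
    by (simp add: finite_edges_mod)
qed

lemma sum_out_arcs:
  fixes F :: "(real ^ 'd) \<times> (real ^ 'd) \<Rightarrow> 'c::comm_monoid_add"
  shows "(\<Sum>y\<in>nodes_mod G. \<Sum>e\<in>out_arcs G y. F e) = (\<Sum>e\<in>edges_mod G. F e)"
  unfolding edges_mod_def
  by (rule sum.UNION_disjoint[symmetric])
    (use finite_nodes_mod finite_out_arcs_mod in \<open>auto simp: out_arcs_def\<close>)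

text \<open>
  An edge that ends in the unit cell and one that starts there represent the same class exactly
  when one is carried to the other by the translation that brings the respective other endpoint
  into the unit cell.
\<close>

lemma sum_in_arcs:
  fixes F :: "(real ^ 'd) \<times> (real ^ 'd) \<Rightarrow> 'c::comm_monoid_add"
  assumes F: "translation_invariant F"
  shows "(\<Sum>y\<in>nodes_mod G. \<Sum>e\<in>in_arcs G y. F e) = (\<Sum>e\<in>edges_mod G. F e)"
proof -
  have in_iff: "(x, y) \<in> (\<Union>y\<in>nodes_mod G. in_arcs G y) \<longleftrightarrow> (x, y) \<in> parcs G \<and> y \<in> unit_cell"
    for x y
    using node_of_arc by (auto simp: nodes_mod_def in_arcs_def)
  define start where "start = (\<lambda>(x :: real ^ 'd, y :: real ^ 'd). (x + (reduce x - x), y + (reduce x - x)))"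
  define stop where "stop = (\<lambda>(x :: real ^ 'd, y :: real ^ 'd). (x + (reduce y - y), y + (reduce y - y)))"
  note shift = reduce_minus_self_in_int_lattice
  have "(\<Sum>y\<in>nodes_mod G. \<Sum>e\<in>in_arcs G y. F e) = (\<Sum>e\<in>(\<Union>y\<in>nodes_mod G. in_arcs G y). F e)"
    by (rule sum.UNION_disjoint[symmetric])
      (use finite_nodes_mod finite_in_arcs_mod in \<open>auto simp: in_arcs_def\<close>)
  also have "\<dots> = (\<Sum>e\<in>edges_mod G. F e)"
  proof (rule sum.reindex_bij_witness[where i = stop and j = start])
    fix e assume e: "e \<in> (\<Union>y\<in>nodes_mod G. in_arcs G y)"
    obtain x y where xy: "e = (x, y)"
      by (cases e)
    with e have arc: "(x, y) \<in> parcs G" and y: "y \<in> unit_cell"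
      by (simp_all only: in_iff)
    have "reduce (y + (reduce x - x)) = y"
      using reduce_translate[OF shift] reduce_id[OF y] by metis
    then show "stop (start e) = e"
      by (simp add: xy start_def stop_def)
    show "start e \<in> edges_mod G"
      using edge_translate[OF shift arc, of x] reduce_in_unit_cell[of x]
      by (simp add: xy start_def edges_mod_iff)
    have "F (x + (reduce x - x), y + (reduce x - x)) = F (x, y)"
      using F arc shift unfolding translation_invariant_def by blast
    then show "F (start e) = F e"
      by (simp add: xy start_def)
  next
    fix e assume e: "e \<in> edges_mod G"
    obtain x y where xy: "e = (x, y)"
      by (cases e)
    with e have arc: "(x, y) \<in> parcs G" and x: "x \<in> unit_cell"
      by (simp_all add: edges_mod_iff)
    have "reduce (x + (reduce y - y)) = x"
      using reduce_translate[OF shift] reduce_id[OF x] by metis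
    then show "start (stop e) = e"
      by (simp add: xy start_def stop_def)
    have "stop e = (x + (reduce y - y), reduce y)"
      by (simp add: xy stop_def)
    then show "stop e \<in> (\<Union>y\<in>nodes_mod G. in_arcs G y)"
      using edge_translate[OF shift arc, of y] reduce_in_unit_cell[of y]
      by (simp only: in_iff) simp
  qed
  finally show ?thesis .
qed

lemma edges_mod_reduce_fst: "e \<in> edges_mod G \<Longrightarrow> reduce (fst e) = fst e"
  by (cases e) (simp add: edges_mod_iff reduce_id)

section \<open>Duality and the Dirichlet form\<close>

lemma sum_gen:
  fixes f g :: "real ^ 'd \<Rightarrow> real"
  shows "(\<Sum>y\<in>nodes_mod G. g y * gen G lam f y) =
    (\<Sum>e\<in>edges_mod G. lam e * g (fst e) * (f (reduce (snd e)) - f (fst e)))"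
  unfolding sum_out_arcs[symmetric]
  by (intro sum.cong refl)
    (auto simp: gen_def sum_distrib_left jump_def out_arcs_def intro!: sum.cong)

lemma sum_gen_transpose:
  fixes f g :: "real ^ 'd \<Rightarrow> real"
  shows "(\<Sum>y\<in>nodes_mod G. f y * gen_transpose G lam g y) =
    (\<Sum>y\<in>nodes_mod G. g y * gen G lam f y)"
proof -
  let ?F = "\<lambda>e. lam e * g (reduce (fst e)) * f (reduce (snd e))"
  have "(\<Sum>y\<in>nodes_mod G. f y * gen_transpose G lam g y) =
      (\<Sum>y\<in>nodes_mod G. \<Sum>e\<in>in_arcs G y. ?F e) -
      (\<Sum>y\<in>nodes_mod G. \<Sum>e\<in>out_arcs G y. lam e * g (fst e) * f (fst e))"
    unfolding sum_subtractf[symmetric]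
    by (intro sum.cong refl)
      (auto simp: gen_transpose_def right_diff_distrib sum_distrib_left sum_distrib_right jump_def
        nodes_mod_reduce out_arcs_def in_arcs_def
        intro!: arg_cong2[where f = "(-)"] sum.cong)
  also have "(\<Sum>y\<in>nodes_mod G. \<Sum>e\<in>in_arcs G y. ?F e) = (\<Sum>e\<in>edges_mod G. ?F e)"
    by (rule sum_in_arcs) (auto simp: translation_invariant_def reduce_translate rate_translate)
  also have "\<dots> - (\<Sum>y\<in>nodes_mod G. \<Sum>e\<in>out_arcs G y. lam e * g (fst e) * f (fst e)) =
      (\<Sum>y\<in>nodes_mod G. g y * gen G lam f y)"
    unfolding sum_gen sum_out_arcs sum_subtractf[symmetric]
    by (intro sum.cong refl) (simp add: edges_mod_reduce_fst right_diff_distrib)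
  finally show ?thesis .
qed

text \<open>
  The product rule for \<open>L\<close> has the edgewise products of increments as its defect, and
  \<open>\<langle>\<pi>, L(f g)\<rangle> = \<langle>L\<^sup>T \<pi>, f g\<rangle> = 0\<close>.
\<close>

lemma dirichlet_form_eq:
  fixes f g :: "real ^ 'd \<Rightarrow> real"
  assumes "\<forall>y\<in>nodes_mod G. gen_transpose G lam \<pi> y = 0"
  shows "(\<Sum>e\<in>edges_mod G. lam e * \<pi> (fst e) *
      ((f (reduce (snd e)) - f (fst e)) * (g (reduce (snd e)) - g (fst e)))) =
    - (\<Sum>y\<in>nodes_mod G. (\<pi> y * f y) * gen G lam g y)
    - (\<Sum>y\<in>nodes_mod G. (\<pi> y * g y) * gen G lam f y)"
proof -
  have "0 = (\<Sum>y\<in>nodes_mod G. \<pi> y * gen G lam (\<lambda>z. f z * g z) y)"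
    using assms sum_gen_transpose[of "\<lambda>z. f z * g z" \<pi>] by simp
  also have "\<dots> = (\<Sum>e\<in>edges_mod G. lam e * \<pi> (fst e) *
      ((f (reduce (snd e)) - f (fst e)) * (g (reduce (snd e)) - g (fst e)))) +
    (\<Sum>y\<in>nodes_mod G. (\<pi> y * f y) * gen G lam g y) +
    (\<Sum>y\<in>nodes_mod G. (\<pi> y * g y) * gen G lam f y)"
    unfolding sum_gen sum.distrib[symmetric]
    by (intro sum.cong refl) (simp add: algebra_simps)
  finally show ?thesis
    by linarith
qed

section \<open>Comparison of the two matrices\<close>

lemma sum_drift:
  "(\<Sum>y\<in>nodes_mod G. g y * drift G lam y $ i) = (\<Sum>e\<in>edges_mod G. lam e * g (fst e) * jump e $ i)"
  unfolding sum_out_arcs[symmetric]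
  by (intro sum.cong refl)
    (auto simp: drift_def sum_distrib_left out_arcs_def intro!: sum.cong)

lemma sum_cell_source:
  "(\<Sum>y\<in>nodes_mod G. f y * cell_source G lam \<pi> y $ j) =
    (\<Sum>e\<in>edges_mod G. lam e * \<pi> (fst e) * (f (reduce (snd e)) * jump e $ j))"
proof -
  let ?F = "\<lambda>e. lam e * \<pi> (reduce (fst e)) * (f (reduce (snd e)) * jump e $ j)"
  have "(\<Sum>y\<in>nodes_mod G. f y * cell_source G lam \<pi> y $ j) =
      (\<Sum>y\<in>nodes_mod G. \<Sum>e\<in>in_arcs G y. ?F e)"
    by (intro sum.cong refl)
      (auto simp: cell_source_def sum_distrib_left jump_def in_arcs_def nodes_mod_reduce
        intro!: sum.cong)
  also have "\<dots> = (\<Sum>e\<in>edges_mod G. ?F e)"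
    by (rule sum_in_arcs)
      (auto simp: translation_invariant_def reduce_translate rate_translate jump_def)
  also have "\<dots> = (\<Sum>e\<in>edges_mod G. lam e * \<pi> (fst e) * (f (reduce (snd e)) * jump e $ j))"
    by (intro sum.cong refl) (simp add: edges_mod_reduce_fst)
  finally show ?thesis .
qed

text \<open>
  Duality lets the two correctors be exchanged: the potential sits at the end of the edge because
  \<open>\<sigma>\<close> collects incoming edges, whereas \<open>\<rho>\<close> collects outgoing ones.
\<close>

lemma sum_jump_cell_solution:
  assumes cell: "\<forall>y\<in>nodes_mod G. gen_transpose G lam \<omega> y = cell_source G lam \<pi> y"
    and corr: "\<forall>y\<in>nodes_mod G. gen G lam \<psi> y = drift G lam y"
  shows "(\<Sum>e\<in>edges_mod G. lam e * \<omega> (fst e) $ j * jump e $ i) =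
    (\<Sum>e\<in>edges_mod G. lam e * \<pi> (fst e) * (\<psi> (reduce (snd e)) $ i * jump e $ j))"
proof -
  have "(\<Sum>e\<in>edges_mod G. lam e * \<omega> (fst e) $ j * jump e $ i) =
      (\<Sum>y\<in>nodes_mod G. \<omega> y $ j * gen G lam (\<lambda>z. \<psi> z $ i) y)"
    using corr sum_drift[of "\<lambda>y. \<omega> y $ j" i] by (simp add: gen_component[symmetric])
  also have "\<dots> = (\<Sum>y\<in>nodes_mod G. \<psi> y $ i * gen_transpose G lam (\<lambda>z. \<omega> z $ j) y)"
    by (rule sum_gen_transpose[symmetric])
  also have "\<dots> = (\<Sum>e\<in>edges_mod G. lam e * \<pi> (fst e) * (\<psi> (reduce (snd e)) $ i * jump e $ j))"
    using cell sum_cell_source[of "\<lambda>y. \<psi> y $ i" \<pi> j]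
    by (simp add: gen_transpose_component[symmetric])
  finally show ?thesis .
qed

lemma diffusivity_cell_component:
  "diffusivity_cell G lam \<pi> \<omega> $ i $ j = 1/2 *
    ((\<Sum>e\<in>edges_mod G. lam e * \<pi> (fst e) * (jump e $ i * jump e $ j))
     - (\<Sum>e\<in>edges_mod G. lam e * \<omega> (fst e) $ j * jump e $ i)
     - (\<Sum>e\<in>edges_mod G. lam e * \<omega> (fst e) $ i * jump e $ j))"
  unfolding sum_out_arcs[symmetric] sum_subtractf[symmetric]
  by (auto simp: diffusivity_cell_def outer_def out_arcs_def intro!: sum.cong)

text \<open>
  With \<open>\<Delta>\<close> for the increment of \<open>\<psi>\<close> along an edge,
  \<open>\<alpha>\<^sub>i \<alpha>\<^sub>j = \<nu>\<^sub>i \<nu>\<^sub>j - \<nu>\<^sub>i \<Delta>\<^sub>j - \<Delta>\<^sub>i \<nu>\<^sub>j + \<Delta>\<^sub>i \<Delta>\<^sub>j\<close>, and \<open>L \<psi> = \<rho>\<close> turns the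
  \<open>\<pi>\<close>-weighted sum of the last product into minus that of
  \<open>\<psi>\<^sub>i(\<partial>\<^sub>-e) \<nu>\<^sub>j + \<psi>\<^sub>j(\<partial>\<^sub>-e) \<nu>\<^sub>i\<close>.
\<close>

lemma diffusivity_clt_component:
  assumes stat: "\<forall>y\<in>nodes_mod G. gen_transpose G lam \<pi> y = 0"
    and corr: "\<forall>y\<in>nodes_mod G. gen G lam \<psi> y = drift G lam y"
  shows "diffusivity_clt G lam \<pi> \<psi> $ i $ j = 1/2 *
    ((\<Sum>e\<in>edges_mod G. lam e * \<pi> (fst e) * (jump e $ i * jump e $ j))
     - (\<Sum>e\<in>edges_mod G. lam e * \<pi> (fst e) * (\<psi> (reduce (snd e)) $ i * jump e $ j))
     - (\<Sum>e\<in>edges_mod G. lam e * \<pi> (fst e) * (\<psi> (reduce (snd e)) $ j * jump e $ i)))"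
proof -
  have weighted: "(\<Sum>y\<in>nodes_mod G. (\<pi> y * \<psi> y $ k) * gen G lam (\<lambda>z. \<psi> z $ l) y) =
      (\<Sum>e\<in>edges_mod G. lam e * (\<pi> (fst e) * \<psi> (fst e) $ k) * jump e $ l)" for k l
    using corr sum_drift[of "\<lambda>y. \<pi> y * \<psi> y $ k" l] by (simp add: gen_component[symmetric])
  note dirichlet = dirichlet_form_eq[OF stat, of "\<lambda>z. \<psi> z $ i" "\<lambda>z. \<psi> z $ j", unfolded weighted]
  have "2 * diffusivity_clt G lam \<pi> \<psi> $ i $ j = (\<Sum>e\<in>edges_mod G. lam e * \<pi> (fst e) *
      ((jump e $ i - (\<psi> (reduce (snd e)) $ i - \<psi> (fst e) $ i)) *
       (jump e $ j - (\<psi> (reduce (snd e)) $ j - \<psi> (fst e) $ j))))"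
    by (simp add: diffusivity_clt_def outer_def corrected_jump_def edges_mod_reduce_fst
        cong: sum.cong)
  also have "\<dots> =
      (\<Sum>e\<in>edges_mod G. lam e * \<pi> (fst e) * (jump e $ i * jump e $ j))
      - (\<Sum>e\<in>edges_mod G. lam e * \<pi> (fst e) * (\<psi> (reduce (snd e)) $ i * jump e $ j))
      - (\<Sum>e\<in>edges_mod G. lam e * \<pi> (fst e) * (\<psi> (reduce (snd e)) $ j * jump e $ i))
      + (\<Sum>e\<in>edges_mod G. lam e * (\<pi> (fst e) * \<psi> (fst e) $ i) * jump e $ j)
      + (\<Sum>e\<in>edges_mod G. lam e * (\<pi> (fst e) * \<psi> (fst e) $ j) * jump e $ i)
      + (\<Sum>e\<in>edges_mod G. lam e * \<pi> (fst e) *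
          ((\<psi> (reduce (snd e)) $ i - \<psi> (fst e) $ i) * (\<psi> (reduce (snd e)) $ j - \<psi> (fst e) $ j)))"
    unfolding sum.distrib[symmetric] sum_subtractf[symmetric]
    by (intro sum.cong refl) (simp add: algebra_simps)
  finally show ?thesis
    using dirichlet by simp
qed

end

theorem theoremA3:
  fixes G :: "(real ^ 'd) pair_pre_digraph"
    and lam :: "(real ^ 'd) \<times> (real ^ 'd) \<Rightarrow> real"
    and \<pi> :: "real ^ 'd \<Rightarrow> real"
    and \<omega> \<psi> :: "real ^ 'd \<Rightarrow> real ^ 'd"
  assumes graph: "periodic_weighted_digraph G lam"
    and stationary: "stationary_distribution G lam \<pi>"
    and null_drift: "mean_drift G lam \<pi> = 0"
    and cell_problem: "\<forall>y\<in>nodes_mod G. gen_transpose G lam \<omega> y = cell_source G lam \<pi> y"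
    and corrector: "\<forall>y\<in>nodes_mod G. gen G lam \<psi> y = drift G lam y"
  shows "diffusivity_cell G lam \<pi> \<omega> = diffusivity_clt G lam \<pi> \<psi>"
proof -
  interpret periodic_weighted_digraph G lam
    by (rule graph)
  have "\<forall>y\<in>nodes_mod G. gen_transpose G lam \<pi> y = 0"
    using stationary by (simp add: stationary_distribution_def)
  then have "diffusivity_cell G lam \<pi> \<omega> $ i $ j = diffusivity_clt G lam \<pi> \<psi> $ i $ j" for i j
    using sum_jump_cell_solution[OF cell_problem corrector]
    by (simp add: diffusivity_cell_component diffusivity_clt_component[OF _ corrector])
  then show ?thesis
    by (simp add: vec_eq_iff)
qed

end
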